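(* Let $G$ be a finite graph, $n$ a positive integer, and let $A$ be a commutative associative algebra over $\mathbb{Z}$ that is free as a $\mathbb{Z}$-module on generators ("colors") $x_1,\dots,x_n$, such that for each choice of $r$ and $t$ the product $x_r x_t$ is equal either to some $x_u$ or to $0$. Let $H^k(G,A)$ be the color homology groups of $G$ with respect to $A$. Then the number $C_G(n)$ of proper node colorings of $G$ with $n$ colors satisfies $$C_{G}(n) = \chi(H^{\star}(G, A)),$$ where $\chi(H^{\star}(G,A))=\sum_k(-1)^k\operatorname{rank}H^k(G,A)$.
   Context: $G$ is a finite graph. A coloring of the nodes of $G$ is proper if the two ends of every edge receive distinct colors (so a graph with a loop has no proper coloring). A subgraph $S$ of $G$ consists of all nodes of $G$ and a subset of its edges. Color complex: an enhancement $s$ of a subgraph $S$ is an assignment of a color from $\{x_1,\dots,x_n\}$ to each connected component of $S$. $C^k(G,A)$ is the free abelian group on all enhancements of subgraphs with exactly $k$ edges. For an enhanced state $s$ over $S$ and an edge $e$ of $G$ not in $S$, define $\partial_e(s)$ as follows: if the ends of $e$ lie in the same component of $S$, colored $x$, then $\partial_e(s)$ is obtained by adding $e$ and keeping the color $x$ on that component; if the ends of $e$ lie in different components colored $x$ and $x'$, then $\partial_e(s)$ is obtained by adding $e$ and giving the merged component the product color $xx'$, with $\partial_e(s)=0$ if $xx'=0$; other components keep their colors. Fix an ordering of the edges of $G$ and set $d(s)=\sum_{e\in G-S}(-1)^{\pi(e,s)}\partial_e(s)$, the sum over edges of $G$ not in $S$, where $\pi(e,s)$ is the number of edges of $G-S$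 preceding $e$ in the ordering. Then $d:C^k(G,A)\to C^{k+1}(G,A)$, $d\circ d=0$, and $H^k(G,A)$ is the kernel of $d$ on $C^k(G,A)$ modulo the image of $d$ from $C^{k-1}(G,A)$. *)

theory Defs
  imports Complex_Main "HOL-Library.Uprod" "HOL-Library.FuncSet" "HOL-Algebra.Free_Abelian_Groups"
begin

section \<open>Finite graphs, with loops and parallel edges allowed\<close>

record ('v, 'e) multigraph =
  nodes :: "'v set"
  edges :: "'e set"
  ends :: "'e \<Rightarrow> 'v uprod"

locale finite_graph =
  fixes G :: "('v, 'e) multigraph"
  assumes finite_nodes: "finite (nodes G)"
    and finite_edges: "finite (edges G)"
    and ends_in_nodes: "\<And>e. e \<in> edges G \<Longrightarrow> set_uprod (ends G e) \<subseteq> nodes G"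

definition proper_colorings :: "('v, 'e) multigraph \<Rightarrow> nat \<Rightarrow> ('v \<Rightarrow> nat) set" where
  "proper_colorings G n =
     {f \<in> nodes G \<rightarrow>\<^sub>E {1..n}. \<forall>e\<in>edges G. \<forall>u v. ends G e = Upair u v \<longrightarrow> f u \<noteq> f v}"

text \<open>The spanning subgraph of \<open>G\<close> with edge set \<open>S\<close> is represented by \<open>S\<close> itself.
  If \<open>S\<close> consists of edges of a finite graph \<open>G\<close>, then \<open>component G S v \<subseteq> nodes G\<close>
  for every node \<open>v\<close>.\<close>

definition adjacency :: "('v, 'e) multigraph \<Rightarrow> 'e set \<Rightarrow> 'v rel" where
  "adjacency G S = {(u, v). \<exists>e\<in>S. ends G e = Upair u v}"

definition component :: "('v, 'e) multigraph \<Rightarrow> 'e set \<Rightarrow> 'v \<Rightarrow> 'v set" where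
  "component G S v = (adjacency G S)\<^sup>* `` {v}"

definition components :: "('v, 'e) multigraph \<Rightarrow> 'e set \<Rightarrow> 'v set set" where
  "components G S = component G S ` nodes G"


section \<open>Color algebras\<close>

text \<open>The class \<^class>\<open>comm_ring\<close> supplies a commutative associative multiplication,
  distributive over addition; a unit is not required.\<close>

locale color_algebra = Modules.module scale
  for scale :: "int \<Rightarrow> 'a :: comm_ring \<Rightarrow> 'a" +
  fixes x :: "nat \<Rightarrow> 'a" and n :: nat
  assumes scale_mult: "\<And>a y z. scale a (y * z) = scale a y * z"
    and colors_inj: "inj_on x {1..n}"
    and colors_independent: "independent (x ` {1..n})"
    and colors_span: "span (x ` {1..n}) = UNIV"
    and colors_mult: "\<And>r t. r \<in> {1..n} \<Longrightarrow> t \<in> {1..n} \<Longrightarrow>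
          (\<exists>u\<in>{1..n}. x r * x t = x u) \<or> x r * x t = 0"


section \<open>The color complex\<close>

text \<open>An enhanced state is a pair of an edge set and a coloring of its components. Here and below
  \<open>X\<close> is the set of colors, as elements of the algebra.\<close>

type_synonym ('v, 'e, 'a) state = "'e set \<times> ('v set \<Rightarrow> 'a)"

definition states ::
  "('v, 'e) multigraph \<Rightarrow> 'a set \<Rightarrow> nat \<Rightarrow> ('v, 'e, 'a) state set" where
  "states G X k = {(S, c). S \<subseteq> edges G \<and> card S = k \<and> c \<in> components G S \<rightarrow>\<^sub>E X}"

definition chain_group ::
  "('v, 'e) multigraph \<Rightarrow> 'a set \<Rightarrow> nat \<Rightarrow> (('v, 'e, 'a) state \<Rightarrow>\<^sub>0 int) monoid" where
  "chain_group G X k = free_Abelian_group (states G X k)"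

text \<open>\<open>K\<close> and \<open>K'\<close> are the components of the two ends of \<open>e\<close>. The order in which the ends are
  picked is irrelevant because multiplication is commutative.\<close>

definition partial_edge ::
  "('v, 'e) multigraph \<Rightarrow> 'e \<Rightarrow> ('v, 'e, 'a :: comm_ring) state \<Rightarrow> ('v, 'e, 'a) state \<Rightarrow>\<^sub>0 int" where
  "partial_edge G e = (\<lambda>(S, c).
     let (u, v) = (SOME (u, v). ends G e = Upair u v);
         K = component G S u;
         K' = component G S v;
         recolor = (\<lambda>y. \<lambda>L\<in>components G (insert e S). if L = K \<union> K' then y else c L)
     in if K = K' then frag_of (insert e S, recolor (c K))
        else if c K * c K' = 0 then 0
        else frag_of (insert e S, recolor (c K * c K')))"

definition preceding ::
  "('v, 'e) multigraph \<Rightarrow> 'e rel \<Rightarrow> 'e set \<Rightarrow> 'e \<Rightarrow> nat" where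
  "preceding G ord S e = card {f \<in> edges G - S. f \<noteq> e \<and> (f, e) \<in> ord}"

definition differential ::
  "('v, 'e) multigraph \<Rightarrow> 'e rel \<Rightarrow> (('v, 'e, 'a :: comm_ring) state \<Rightarrow>\<^sub>0 int)
     \<Rightarrow> (('v, 'e, 'a) state \<Rightarrow>\<^sub>0 int)" where
  "differential G ord = frag_extend (\<lambda>s. \<Sum>e\<in>edges G - fst s.
     frag_cmul ((-1) ^ preceding G ord (fst s) e) (partial_edge G e s))"

definition cycles ::
  "('v, 'e) multigraph \<Rightarrow> 'e rel \<Rightarrow> 'a :: comm_ring set \<Rightarrow> nat \<Rightarrow> (('v, 'e, 'a) state \<Rightarrow>\<^sub>0 int) set" where
  "cycles G ord X k = kernel (chain_group G X k) (chain_group G X (Suc k)) (differential G ord)"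

text \<open>There are no chains in degree \<open>-1\<close>.\<close>

definition boundaries ::
  "('v, 'e) multigraph \<Rightarrow> 'e rel \<Rightarrow> 'a :: comm_ring set \<Rightarrow> nat \<Rightarrow> (('v, 'e, 'a) state \<Rightarrow>\<^sub>0 int) set" where
  "boundaries G ord X k =
     (case k of 0 \<Rightarrow> {0} | Suc j \<Rightarrow> differential G ord ` carrier (chain_group G X j))"

definition color_homology ::
  "('v, 'e) multigraph \<Rightarrow> 'e rel \<Rightarrow> 'a :: comm_ring set \<Rightarrow> nat
     \<Rightarrow> (('v, 'e, 'a) state \<Rightarrow>\<^sub>0 int) set monoid" where
  "color_homology G ord X k =
     subgroup_generated (chain_group G X k) (cycles G ord X k) Mod boundaries G ord X k"


section \<open>Rank and Euler characteristic\<close>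

text \<open>\<open>group_rank\<close> is meant for abelian groups of finite rank (for example finitely generated
  ones), where the cardinalities below are bounded and hence \<open>Sup\<close> is their maximum.\<close>

definition int_independent :: "('b, 'm) monoid_scheme \<Rightarrow> 'b set \<Rightarrow> bool" where
  "int_independent H B \<longleftrightarrow>
     (\<forall>a :: 'b \<Rightarrow> int. finprod H (\<lambda>b. b [^]\<^bsub>H\<^esub> a b) B = \<one>\<^bsub>H\<^esub> \<longrightarrow> (\<forall>b\<in>B. a b = 0))"

definition group_rank :: "('b, 'm) monoid_scheme \<Rightarrow> nat" where
  "group_rank H = Sup {card B | B. finite B \<and> B \<subseteq> carrier H \<and> int_independent H B}"

text \<open>The sum is over all degrees in which there are any states.\<close>

definition homology_euler_char ::
  "('v, 'e) multigraph \<Rightarrow> 'e rel \<Rightarrow> 'a :: comm_ring set \<Rightarrow> int" where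
  "homology_euler_char G ord X =
     (\<Sum>k\<le>card (edges G). (-1) ^ k * int (group_rank (color_homology G ord X k)))"

end

theory Submission
  imports Defs
begin

text \<open>
  Let \<open>C\<^sub>k\<close> be the group of chains of degree \<open>k\<close>. It is free on the finitely many states over edge sets
  of size \<open>k\<close>, so by the Euler--Poincare principle (\<open>euler_poincare\<close>) the alternating sum of the ranks
  of the homology groups equals the alternating sum of the numbers of states. The states over an
  edge set \<open>S\<close> are the colorings of its components, so there are as many of them as node colorings
  that are constant on the components of \<open>S\<close>. These are the colorings \<open>f\<close> for which \<open>S\<close> consists of
  edges with equally colored ends. Exchanging the summations over \<open>S\<close> and \<open>f\<close>
  (\<open>sum_component_colorings\<close>), the contribution of \<open>f\<close> is the sum of \<open>(-1)\<^bsup>|S|\<^esup>\<close> over all sets \<open>S\<close> of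
  such edges; it is \<open>1\<close> if \<open>f\<close> is proper and \<open>0\<close> otherwise.

  The Euler--Poincare principle rests on the additivity of rank. The rank of a quotient \<open>Z / N\<close> is
  treated as the maximal number of elements of \<open>Z\<close> that are linearly independent modulo \<open>N\<close>; the analogue
  of the exchange lemma is that a homogeneous linear system with more unknowns than equations has
  a nontrivial solution. The lemma \<open>group_rank_quotient\<close> relates this notion to the rank of the factor
  group.

  The principle also needs that the differential squares to zero (\<open>differential_differential\<close>). The
  signs make the contributions of an ordered pair of edges and of the reversed pair cancel, provided
  that adding two edges gives the same result in both orders. To see this without distinguishing
  vanishing from nonvanishing products, colorings of components may take the value \<open>0\<close> while edges are
  added, and a state with a component of color \<open>0\<close> is read as the chain \<open>0\<close>. Then adding an edge is
  a total operation on colorings (\<open>merge\<close>), and commutation (\<open>merge_commute\<close>) follows from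
  the commutativity and associativity of multiplication.
\<close>

section \<open>Relative rank of submodules over an integral domain\<close>

lemma homogeneous_system_nontrivial_solution:
  fixes a :: "'d \<Rightarrow> 'b \<Rightarrow> 'r::idom"
  assumes "finite B" "finite D" "card B < card D"
  shows "\<exists>y. (\<exists>z\<in>D. y z \<noteq> 0) \<and> (\<forall>b\<in>B. (\<Sum>z\<in>D. y z * a z b) = 0)"
  using assms
proof (induction B arbitrary: D a rule: finite_induct)
  case empty
  then have "D \<noteq> {}" by auto
  then show ?case by (intro exI[of _ "\<lambda>_. 1"]) auto
next
  case (insert b B)
  show ?case
  proof (cases "\<exists>z0\<in>D. a z0 b \<noteq> 0")
    case False
    moreover obtain y where "\<exists>z\<in>D. y z \<noteq> 0" "\<forall>b\<in>B. (\<Sum>z\<in>D. y z * a z b) = 0"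
      using insert.IH[of D a] insert.prems insert.hyps by auto
    ultimately show ?thesis by (intro exI[of _ y]) auto
  next
    case True
    then obtain z0 where z0: "z0 \<in> D" "a z0 b \<noteq> 0" by blast
    define D' where "D' = D - {z0}"
    have D': "finite D'" "card B < card D'" "z0 \<notin> D'" "D = insert z0 D'"
      using insert.prems insert.hyps z0 by (auto simp: D'_def)
    \<comment> \<open>Eliminate the unknown of index \<open>z0\<close> from the equations of index \<open>c \<in> B\<close>.\<close>
    define a' where "a' = (\<lambda>z c. a z0 b * a z c - a z b * a z0 c)"
    obtain y' where y': "\<exists>z\<in>D'. y' z \<noteq> 0" "\<forall>c\<in>B. (\<Sum>z\<in>D'. y' z * a' z c) = 0"
      using insert.IH[of D' a'] D' by auto
    define t where "t = - (\<Sum>z\<in>D'. y' z * a z b)"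
    define y where "y = (\<lambda>z. if z = z0 then t else a z0 b * y' z)"
    have sum_y: "(\<Sum>z\<in>D. y z * a z c) = t * a z0 c + a z0 b * (\<Sum>z\<in>D'. y' z * a z c)" for c
    proof -
      have "(\<Sum>z\<in>D'. y z * a z c) = (\<Sum>z\<in>D'. a z0 b * (y' z * a z c))"
        using D'(3) by (intro sum.cong) (auto simp: y_def)
      then show ?thesis
        using D' by (simp add: y_def sum_distrib_left)
    qed
    have "(\<Sum>z\<in>D. y z * a z c) = 0" if "c \<in> insert b B" for c
    proof (cases "c = b")
      case True
      then show ?thesis by (simp add: sum_y t_def mult.commute)
    next
      case False
      then have "0 = (\<Sum>z\<in>D'. y' z * a' z c)" using y' that by simp
      also have "\<dots> = a z0 b * (\<Sum>z\<in>D'. y' z * a z c) - (\<Sum>z\<in>D'. y' z * a z b) * a z0 c"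
        by (simp add: a'_def sum_distrib_left sum_distrib_right sum_subtractf algebra_simps)
      finally show ?thesis by (simp add: sum_y t_def)
    qed
    moreover have "\<exists>z\<in>D. y z \<noteq> 0"
      using y'(1) D' z0 by (auto simp: y_def)
    ultimately show ?thesis by (intro exI[of _ y]) auto
  qed
qed

text \<open>Modules over an integral domain, with the ring acting through \<open>*s\<close>.\<close>

locale idom_module = Modules.module scale
  for scale :: "'r::idom \<Rightarrow> 'm::ab_group_add \<Rightarrow> 'm"  (infixr \<open>*s\<close> 75)
begin

text \<open>\<open>D\<close> is a finite set, linearly independent modulo \<open>N\<close>.\<close>

definition rel_independent :: "'m set \<Rightarrow> 'm set \<Rightarrow> bool" where
  "rel_independent N D \<longleftrightarrow>
     finite D \<and> (\<forall>a. (\<Sum>b\<in>D. a b *s b) \<in> N \<longrightarrow> (\<forall>b\<in>D. a b = 0))"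

text \<open>The rank of \<open>Z / N\<close>, for submodules \<open>N \<subseteq> Z\<close> with \<open>Z / N\<close> of finite rank: without the latter the
  supremum of natural numbers is meaningless.\<close>

definition rel_rank :: "'m set \<Rightarrow> 'm set \<Rightarrow> nat" where
  "rel_rank Z N = Sup {card D | D. D \<subseteq> Z \<and> rel_independent N D}"

text \<open>A maximal set \<open>B \<subseteq> Z\<close> of elements independent modulo \<open>N\<close>. It need not span \<open>Z\<close> modulo \<open>N\<close>: it is only
  required that every \<open>z \<in> Z\<close> has a nonzero multiple in the span, so that \<open>Z / N\<close> may have torsion.\<close>

definition rel_basis :: "'m set \<Rightarrow> 'm set \<Rightarrow> 'm set \<Rightarrow> bool" where
  "rel_basis Z N B \<longleftrightarrow> B \<subseteq> Z \<and> rel_independent N B \<and>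
     (\<forall>z\<in>Z. \<exists>m a. m \<noteq> 0 \<and> m *s z - (\<Sum>b\<in>B. a b *s b) \<in> N)"

lemma rel_independentD:
  assumes "rel_independent N D" "(\<Sum>b\<in>D. a b *s b) \<in> N" "b \<in> D"
  shows "a b = 0"
  using assms unfolding rel_independent_def by blast

lemma rel_basis_generates:
  assumes "rel_basis Z N B" "z \<in> Z"
  obtains m a where "m \<noteq> 0" "m *s z - (\<Sum>b\<in>B. a b *s b) \<in> N"
proof -
  have "\<exists>m a. m \<noteq> 0 \<and> m *s z - (\<Sum>b\<in>B. a b *s b) \<in> N"
    using assms by (simp add: rel_basis_def)
  then show ?thesis using that by (elim exE conjE)
qed

lemma rel_independent_not_mem:
  assumes "rel_independent N D" "b \<in> D"
  shows "b \<notin> N"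
proof
  assume "b \<in> N"
  have "(\<Sum>c\<in>D. (if c = b then 1 else 0) *s c) = (\<Sum>c\<in>D. if c = b then c else 0)"
    by (intro sum.cong) auto
  also have "\<dots> = b" using assms by (simp add: rel_independent_def)
  finally have "(\<Sum>c\<in>D. (if c = b then 1 else 0) *s c) \<in> N" using \<open>b \<in> N\<close> by simp
  from rel_independentD[OF assms(1) this assms(2)] show False by simp
qed

lemma rel_independent_diff_not_mem:
  assumes "rel_independent N D" "b \<in> D" "c \<in> D" "b - c \<in> N"
  shows "b = c"
proof (rule ccontr)
  assume "b \<noteq> c"
  define a :: "'m \<Rightarrow> 'r" where "a = (\<lambda>z. if z = b then 1 else if z = c then -1 else 0)"
  have "(\<Sum>z\<in>D. a z *s z) = (\<Sum>z\<in>{b, c}. a z *s z)"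
    using assms(1-3) by (intro sum.mono_neutral_right) (auto simp: a_def rel_independent_def)
  also have "\<dots> = b - c" using \<open>b \<noteq> c\<close> by (simp add: a_def)
  finally have "(\<Sum>z\<in>D. a z *s z) \<in> N" using assms(4) by simp
  from rel_independentD[OF assms(1) this assms(2)] show False by (simp add: a_def)
qed

text \<open>Write a nonzero multiple of each element of \<open>D\<close> as a combination of \<open>B\<close>. If \<open>D\<close> were larger than \<open>B\<close>,
  a nontrivial solution of the resulting linear system would be a relation on \<open>D\<close> modulo \<open>N\<close>.\<close>

lemma rel_independent_card_le:
  assumes "subspace N" "rel_basis Z N B" "D \<subseteq> Z" "rel_independent N D"
  shows "card D \<le> card B"
proof (rule ccontr)
  assume "\<not> card D \<le> card B"
  have fin: "finite B" "finite D"
    using assms by (auto simp: rel_basis_def rel_independent_def)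
  have "\<forall>z\<in>D. \<exists>m a. m \<noteq> 0 \<and> m *s z - (\<Sum>b\<in>B. a b *s b) \<in> N"
    using assms unfolding rel_basis_def by blast
  then obtain m a where ma: "\<And>z. z \<in> D \<Longrightarrow> m z \<noteq> 0"
    "\<And>z. z \<in> D \<Longrightarrow> m z *s z - (\<Sum>b\<in>B. a z b *s b) \<in> N"
    by metis
  obtain y where y: "\<exists>z\<in>D. y z \<noteq> 0" "\<forall>b\<in>B. (\<Sum>z\<in>D. y z * a z b) = 0"
    using homogeneous_system_nontrivial_solution[OF fin, of a] \<open>\<not> card D \<le> card B\<close> by auto
  have "(\<Sum>z\<in>D. y z *s (\<Sum>b\<in>B. a z b *s b)) = (\<Sum>z\<in>D. \<Sum>b\<in>B. (y z * a z b) *s b)"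
    by (simp add: scale_sum_right)
  also have "\<dots> = (\<Sum>b\<in>B. (\<Sum>z\<in>D. y z * a z b) *s b)"
    by (subst sum.swap) (simp add: scale_sum_left)
  also have "\<dots> = 0" using y by simp
  finally have "(\<Sum>z\<in>D. (y z * m z) *s z) = (\<Sum>z\<in>D. y z *s (m z *s z - (\<Sum>b\<in>B. a z b *s b)))"
    by (simp add: scale_right_diff_distrib sum_subtractf)
  also have "\<dots> \<in> N"
    using ma(2) assms(1) by (auto intro!: subspace_sum subspace_scale)
  finally have "y z * m z = 0" if "z \<in> D" for z
    using rel_independentD[OF assms(4), of "\<lambda>z. y z * m z"] that by auto
  then show False using y ma by auto
qed

lemma rel_rank_eq_card:
  assumes "subspace N" "rel_basis Z N B"
  shows "rel_rank Z N = card B"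
  unfolding rel_rank_def
proof (rule cSup_eq_maximum)
  show "card B \<in> {card D |D. D \<subseteq> Z \<and> rel_independent N D}"
    using assms unfolding rel_basis_def by blast
qed (use rel_independent_card_le[OF assms] in auto)

lemma rel_basis_exists:
  assumes "subspace N" and bounded: "\<And>D. D \<subseteq> Z \<Longrightarrow> rel_independent N D \<Longrightarrow> card D \<le> k"
  shows "\<exists>B. rel_basis Z N B"
proof -
  define P where "P = (\<lambda>D. D \<subseteq> Z \<and> rel_independent N D)"
  have "P {}" by (simp add: P_def rel_independent_def)
  moreover have "\<forall>D. P D \<longrightarrow> card D < Suc k" using bounded by (simp add: P_def less_Suc_eq_le)
  ultimately have "\<exists>B. P B \<and> (\<forall>D. P D \<longrightarrow> card D \<le> card B)"
    by (rule Lattices_Big.ex_has_greatest_nat)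
  then obtain B where B: "P B" and max: "\<And>D. P D \<Longrightarrow> card D \<le> card B"
    by blast
  from B have fin: "finite B" by (simp add: P_def rel_independent_def)
  have "\<exists>m a. m \<noteq> 0 \<and> m *s z - (\<Sum>b\<in>B. a b *s b) \<in> N" if z: "z \<in> Z" for z
  proof (cases "z \<in> B")
    case True
    have "(\<Sum>b\<in>B. (if b = z then 1 else 0) *s b) = (\<Sum>b\<in>B. if b = z then b else 0)"
      by (intro sum.cong) auto
    also have "\<dots> = z" using fin True by simp
    finally show ?thesis
      using subspace_0[OF assms(1)]
      by (intro exI[of _ 1] exI[of _ "\<lambda>b. if b = z then 1 else 0"]) simp
  next
    case False
    then have "\<not> P (insert z B)" using max[of "insert z B"] fin by auto
    then obtain a where a: "(\<Sum>b\<in>insert z B. a b *s b) \<in> N" and ne: "\<exists>b\<in>insert z B. a b \<noteq> 0"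
      using B z fin by (auto simp: P_def rel_independent_def)
    have sum: "a z *s z + (\<Sum>b\<in>B. a b *s b) \<in> N"
      using a fin False by simp
    have "a z \<noteq> 0"
    proof
      assume "a z = 0"
      then have "\<forall>b\<in>B. a b = 0"
        using sum B unfolding P_def rel_independent_def by auto
      then show False using ne \<open>a z = 0\<close> by auto
    qed
    then show ?thesis
      using sum by (intro exI[of _ "a z"] exI[of _ "\<lambda>b. - a b"]) (simp add: sum_negf)
  qed
  then show ?thesis using B unfolding P_def rel_basis_def by blast
qed

lemma rel_basis_exists_subset:
  assumes "rel_basis C {0} F" "Z \<subseteq> C" "subspace N"
  shows "\<exists>B. rel_basis Z N B"
proof (rule rel_basis_exists[OF assms(3), of _ "card F"])
  fix D assume D: "D \<subseteq> Z" "rel_independent N D"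
  then have "rel_independent {0} D"
    using subspace_0[OF assms(3)] by (auto simp: rel_independent_def)
  then show "card D \<le> card F"
    using rel_independent_card_le[OF subspace_single_0 assms(1)] D assms(2) by blast
qed

lemma rel_basis_Un:
  assumes "subspace N" "subspace P" "P \<subseteq> N" "N \<subseteq> Z" "rel_basis Z N B" "rel_basis N P C"
  shows "B \<inter> C = {}" and "rel_basis Z P (B \<union> C)"
proof -
  have C: "C \<subseteq> N" "finite C" "finite B" "B \<subseteq> Z" "rel_independent N B" "rel_independent P C"
    using assms by (auto simp: rel_basis_def rel_independent_def)
  show disj: "B \<inter> C = {}"
    using rel_independent_not_mem C by blast
  have split: "(\<Sum>b\<in>B \<union> C. a b *s b) = (\<Sum>b\<in>B. a b *s b) + (\<Sum>b\<in>C. a b *s b)" for a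
    using disj C by (simp add: sum.union_disjoint)
  have in_N: "(\<Sum>b\<in>C. a b *s b) \<in> N" for a
    using C(1) assms(1) by (intro subspace_sum subspace_scale) auto
  have indep: "\<forall>b\<in>B \<union> C. a b = 0" if a: "(\<Sum>b\<in>B \<union> C. a b *s b) \<in> P" for a
  proof -
    have "(\<Sum>b\<in>B. a b *s b) = (\<Sum>b\<in>B \<union> C. a b *s b) - (\<Sum>b\<in>C. a b *s b)"
      by (simp add: split)
    also have "\<dots> \<in> N" using a in_N assms by (auto intro!: subspace_diff)
    finally have B0: "\<forall>b\<in>B. a b = 0" using rel_independentD[OF C(5), of a] by auto
    then have "(\<Sum>b\<in>C. a b *s b) \<in> P" using a by (simp add: split)
    then show ?thesis using B0 rel_independentD[OF C(6), of a] by auto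
  qed
  have gen: "\<exists>m a. m \<noteq> 0 \<and> m *s z - (\<Sum>b\<in>B \<union> C. a b *s b) \<in> P" if "z \<in> Z" for z
  proof -
    obtain m a where ma: "m \<noteq> 0" "m *s z - (\<Sum>b\<in>B. a b *s b) \<in> N"
      by (rule rel_basis_generates[OF assms(5) \<open>z \<in> Z\<close>])
    from ma(2) obtain m' a' where ma': "m' \<noteq> 0"
      "m' *s (m *s z - (\<Sum>b\<in>B. a b *s b)) - (\<Sum>b\<in>C. a' b *s b) \<in> P"
      by (rule rel_basis_generates[OF assms(6)])
    define a'' where "a'' = (\<lambda>b. if b \<in> B then m' * a b else a' b)"
    have "(\<Sum>b\<in>B. a'' b *s b) = m' *s (\<Sum>b\<in>B. a b *s b)"
      by (simp add: a''_def scale_sum_right)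
    moreover have "(\<Sum>b\<in>C. a'' b *s b) = (\<Sum>b\<in>C. a' b *s b)"
      using disj by (intro sum.cong) (auto simp: a''_def)
    ultimately have "(m' * m) *s z - (\<Sum>b\<in>B \<union> C. a'' b *s b) \<in> P"
      using ma'(2) by (simp add: split scale_right_diff_distrib diff_diff_eq)
    then show ?thesis using ma(1) ma'(1) by (intro exI[of _ "m' * m"] exI[of _ a'']) auto
  qed
  show "rel_basis Z P (B \<union> C)"
    using indep gen C assms(4) by (auto simp: rel_basis_def rel_independent_def)
qed

lemma rel_basis_image:
  assumes f: "module_hom scale scale f"
    and B: "rel_basis Z {z\<in>Z. f z = 0} B" and Z: "subspace Z"
  shows "inj_on f B" and "rel_basis (f ` Z) {0} (f ` B)"
proof -
  interpret f: module_hom scale scale f by (rule f)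
  let ?N = "{z\<in>Z. f z = 0}"
  have BZ: "B \<subseteq> Z" "finite B" "rel_independent ?N B"
    using B by (auto simp: rel_basis_def rel_independent_def)
  have zero: "\<forall>b\<in>B. a b = 0" if "(\<Sum>b\<in>B. a b *s f b) = 0" for a
  proof -
    have "f (\<Sum>b\<in>B. a b *s b) = 0" using that by (simp add: f.sum f.scale)
    moreover have "(\<Sum>b\<in>B. a b *s b) \<in> Z"
      using BZ(1) Z by (intro subspace_sum subspace_scale) auto
    ultimately have "(\<Sum>b\<in>B. a b *s b) \<in> ?N" by (intro CollectI conjI)
    from rel_independentD[OF BZ(3) this] show ?thesis by blast
  qed
  show inj: "inj_on f B"
  proof (rule inj_onI)
    fix b c assume bc: "b \<in> B" "c \<in> B" "f b = f c"
    then have "b - c \<in> ?N"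
      using BZ(1) Z by (auto simp: f.diff intro: subspace_diff)
    then show "b = c"
      by (rule rel_independent_diff_not_mem[OF BZ(3) bc(1,2)])
  qed
  have "rel_independent {0} (f ` B)"
    unfolding rel_independent_def
  proof (intro conjI allI impI)
    fix a assume "(\<Sum>b\<in>f ` B. a b *s b) \<in> {0}"
    then have "(\<Sum>b\<in>B. a (f b) *s f b) = 0" by (simp add: sum.reindex[OF inj])
    from zero[OF this] show "\<forall>b\<in>f ` B. a b = 0" by auto
  qed (use BZ in auto)
  moreover have "\<exists>m a. m \<noteq> 0 \<and> m *s f z - (\<Sum>b\<in>f ` B. a b *s b) = 0" if "z \<in> Z" for z
  proof -
    obtain m a where ma: "m \<noteq> 0" "m *s z - (\<Sum>b\<in>B. a b *s b) \<in> ?N"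
      by (rule rel_basis_generates[OF B \<open>z \<in> Z\<close>])
    then have "f (m *s z - (\<Sum>b\<in>B. a b *s b)) = 0" by simp
    then have "m *s f z - (\<Sum>b\<in>B. a b *s f b) = 0"
      by (simp add: f.diff f.scale f.sum)
    moreover have "(\<Sum>b\<in>f ` B. a (the_inv_into B f b) *s b) = (\<Sum>b\<in>B. a b *s f b)"
      by (simp add: sum.reindex[OF inj] the_inv_into_f_f[OF inj])
    ultimately show ?thesis using ma(1)
      by (intro exI[of _ m] exI[of _ "\<lambda>b. a (the_inv_into B f b)"]) simp
  qed
  ultimately show "rel_basis (f ` Z) {0} (f ` B)"
    using BZ by (auto simp: rel_basis_def)
qed

lemma rel_rank_additive:
  assumes "subspace N" "subspace P" "P \<subseteq> N" "N \<subseteq> Z" "Z \<subseteq> C" "rel_basis C {0} F"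
  shows "rel_rank Z P = rel_rank Z N + rel_rank N P"
proof -
  obtain B where B: "rel_basis Z N B" using rel_basis_exists_subset assms by blast
  obtain B' where B': "rel_basis N P B'" using rel_basis_exists_subset assms by (meson order_trans)
  have "finite B" "finite B'" using B B' by (auto simp: rel_basis_def rel_independent_def)
  then show ?thesis
    using rel_basis_Un[OF assms(1-4) B B'] B B' assms
    by (simp add: rel_rank_eq_card card_Un_disjoint)
qed

text \<open>The first isomorphism theorem, at the level of ranks.\<close>

lemma rel_rank_image:
  assumes f: "module_hom scale scale f" and Z: "subspace Z" and "rel_basis Z {0} F"
  shows "rel_rank (f ` Z) {0} = rel_rank Z {z\<in>Z. f z = 0}"
proof -
  interpret f: module_hom scale scale f by (rule f)
  have sub: "subspace {z\<in>Z. f z = 0}"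
    using Z by (auto simp: subspace_def f.add f.scale)
  then obtain B where B: "rel_basis Z {z\<in>Z. f z = 0} B"
    using rel_basis_exists_subset assms by blast
  show ?thesis
    using rel_basis_image[OF f B Z] B sub
    by (simp add: rel_rank_eq_card card_image)
qed

text \<open>The Euler--Poincare principle for a cochain complex \<open>C\<close> that vanishes in degree \<open>n + 1\<close>, all of whose
  modules have a finite maximal independent set \<open>F k\<close>. The rank of \<open>C k\<close> is the sum of the ranks of the
  homology, of the coboundaries of degree \<open>k\<close> and of those of degree \<open>k + 1\<close>, and the latter two
  telescope in the alternating sum.\<close>

theorem euler_poincare:
  fixes C :: "nat \<Rightarrow> 'm set" and F :: "nat \<Rightarrow> 'm set"
  assumes d: "module_hom scale scale d"
    and C: "\<And>k. subspace (C k)" and basis: "\<And>k. rel_basis (C k) {0} (F k)"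
    and dC: "\<And>k c. c \<in> C k \<Longrightarrow> d c \<in> C (Suc k)"
    and dd: "\<And>k c. c \<in> C k \<Longrightarrow> d (d c) = 0"
    and top: "C (Suc n) = {0}"
  shows "(\<Sum>k\<le>n. (-1) ^ k * int (rel_rank {c \<in> C k. d c = 0}
            (case k of 0 \<Rightarrow> {0} | Suc j \<Rightarrow> d ` C j)))
       = (\<Sum>k\<le>n. (-1) ^ k * int (card (F k)))"
proof -
  interpret d: module_hom scale scale d by (rule d)
  define Z where "Z k = {c \<in> C k. d c = 0}" for k
  define B where "B k = (case k of 0 \<Rightarrow> {0} | Suc j \<Rightarrow> d ` C j)" for k
  have subZ: "subspace (Z k)" for k
    using C[of k] by (auto simp: Z_def subspace_def d.add d.scale)
  have subB: "subspace (B k)" for k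
    using C by (auto simp: B_def split: nat.split intro: d.subspace_image)
  have BZ: "B k \<subseteq> Z k" for k
    using C subspace_0 dC dd by (auto simp: B_def Z_def split: nat.splits)
  have ZC: "Z k \<subseteq> C k" for k by (auto simp: Z_def)
  have zero_rank: "rel_rank {0} {0} = 0"
  proof -
    have "rel_basis {0} {0} {}"
      by (auto simp: rel_basis_def rel_independent_def intro: exI[of _ 1])
    then show ?thesis by (simp add: rel_rank_eq_card)
  qed
  have step: "card (F k) = rel_rank (Z k) (B k) + rel_rank (B k) {0} + rel_rank (B (Suc k)) {0}" for k
  proof -
    have "card (F k) = rel_rank (C k) {0}"
      using rel_rank_eq_card[OF subspace_single_0 basis] by simp
    also have "\<dots> = rel_rank (C k) (Z k) + rel_rank (Z k) {0}"
      using rel_rank_additive[OF subZ subspace_single_0 _ ZC order_refl basis] subspace_0[OF subZ]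
      by simp
    also have "rel_rank (Z k) {0} = rel_rank (Z k) (B k) + rel_rank (B k) {0}"
      using rel_rank_additive[OF subB subspace_single_0 _ BZ ZC basis] subspace_0[OF subB]
      by simp
    also have "rel_rank (C k) (Z k) = rel_rank (B (Suc k)) {0}"
      using rel_rank_image[OF d C basis, of k] by (simp add: B_def Z_def)
    finally show ?thesis by simp
  qed
  have "(\<Sum>k\<le>m. (-1) ^ k * int (rel_rank (Z k) (B k)))
      = (\<Sum>k\<le>m. (-1) ^ k * int (card (F k))) - (-1) ^ m * int (rel_rank (B (Suc m)) {0})" for m
  proof (induction m)
    case 0
    show ?case using step[of 0] zero_rank by (simp add: B_def)
  next
    case (Suc m)
    show ?case using step[of "Suc m"] by (simp add: Suc.IH algebra_simps)
  qed
  moreover have "B (Suc n) = {0}"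
    using BZ[of "Suc n"] ZC[of "Suc n"] top subspace_0[OF subB] by blast
  ultimately show ?thesis using zero_rank by (simp add: Z_def B_def)
qed

end


section \<open>Quotients of subgroups of free abelian groups\<close>

interpretation frag: idom_module frag_cmul
  by standard (simp_all add: frag_cmul_distrib frag_cmul_distrib2)

\<comment> \<open>It is the reverse of the simplification rule \<open>minus_frag_cmul\<close>.\<close>
declare frag.scale_minus_left [simp del]

lemma module_hom_frag_extend: "module_hom frag_cmul frag_cmul (frag_extend f)"
  by standard (simp_all add: frag_extend_add frag_extend_cmul)

lemma rel_basis_free_Abelian_group:
  assumes "finite S"
  shows "frag.rel_basis (carrier (free_Abelian_group S)) {0} (frag_of ` S)"
proof -
  have inj: "inj_on frag_of S" by (simp add: inj_on_def frag_of_eq)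
  have lookup: "Poly_Mapping.lookup (\<Sum>b\<in>frag_of ` S. frag_cmul (a b) b) s = a (frag_of s)"
    if "s \<in> S" for a s
  proof -
    have "Poly_Mapping.lookup (\<Sum>b\<in>frag_of ` S. frag_cmul (a b) b) s
        = (\<Sum>t\<in>S. if t = s then a (frag_of t) else 0)"
      by (simp add: sum.reindex[OF inj] Poly_Mapping.lookup_sum) (intro sum.cong, auto)
    then show ?thesis using assms that by simp
  qed
  have "a b = 0" if "(\<Sum>b\<in>frag_of ` S. frag_cmul (a b) b) = 0" "b \<in> frag_of ` S" for a b
    using that lookup[of _ a] by auto
  moreover have "\<exists>m a. m \<noteq> 0 \<and> frag_cmul m z - (\<Sum>b\<in>frag_of ` S. frag_cmul (a b) b) = 0"
    if z: "Poly_Mapping.keys z \<subseteq> S" for z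
  proof -
    define a where "a = (\<lambda>b. Poly_Mapping.lookup z (the_inv frag_of b))"
    have inv: "the_inv frag_of (frag_of s) = s" for s :: 'a
      by (intro the_inv_f_f injI) (simp add: frag_of_eq)
    have "(\<Sum>b\<in>frag_of ` S. frag_cmul (a b) b) = (\<Sum>s\<in>S. frag_cmul (Poly_Mapping.lookup z s) (frag_of s))"
      by (simp add: sum.reindex[OF inj] a_def inv)
    also have "\<dots> = frag_extend frag_of z"
      unfolding frag_extend_def using z assms
      by (intro sum.mono_neutral_right) (auto simp: in_keys_iff)
    also have "\<dots> = z" by (rule frag_expansion[symmetric])
    finally show ?thesis by (intro exI[of _ 1] exI[of _ a]) simp
  qed
  ultimately show ?thesis
    using assms by (auto simp: frag.rel_basis_def frag.rel_independent_def)
qed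

text \<open>A set of cosets is independent in the factor group if and only if a set of representatives, one for
  each coset, is independent modulo \<open>N\<close>.\<close>

lemma group_rank_quotient:
  fixes Z N :: "('b \<Rightarrow>\<^sub>0 int) set"
  assumes Z: "frag.subspace Z" and N: "frag.subspace N" and "N \<subseteq> Z"
    and "Z \<subseteq> carrier (free_Abelian_group S)"
  shows "group_rank (subgroup_generated (free_Abelian_group S) Z Mod N) = frag.rel_rank Z N"
proof -
  let ?F = "free_Abelian_group S"
  define H where "H = subgroup_generated ?F Z"
  define Q where "Q = H Mod N"
  define \<pi> where "\<pi> = (\<lambda>z. N #>\<^bsub>H\<^esub> z)"
  interpret F: comm_group ?F by (rule abelian_free_Abelian_group)
  have sub: "subgroup A ?F" if "frag.subspace A" "A \<subseteq> Z" for A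
    using that assms(4)
    by (intro F.subgroupI) (auto simp: frag.subspace_neg frag.subspace_add subset_iff dest: frag.subspace_0)
  interpret H: comm_group H
    unfolding H_def by (rule F.abelian_subgroup_generated) (rule abelian_free_Abelian_group)
  have carrier_H: "carrier H = Z"
    unfolding H_def by (rule subgroup.carrier_subgroup_generated_subgroup[OF sub[OF Z order_refl]])
  have subN: "subgroup N H"
    unfolding H_def using sub[OF N \<open>N \<subseteq> Z\<close>] \<open>N \<subseteq> Z\<close> by (intro F.subgroup_of_subgroup_generated)
  interpret Q: comm_group Q
    unfolding Q_def by (rule H.abelian_FactGroup[OF subN])
  interpret N: normal N H
    using subN by (rule H.subgroup_imp_normal)
  have \<pi>: "\<pi> \<in> hom H Q" unfolding \<pi>_def Q_def by (rule N.r_coset_hom_Mod)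
  have \<pi>_carrier: "\<pi> z \<in> carrier Q" if "z \<in> Z" for z
    using hom_in_carrier[OF \<pi>] that carrier_H by simp
  have \<pi>_add: "\<pi> (y + z) = \<pi> y \<otimes>\<^bsub>Q\<^esub> \<pi> z" if "y \<in> Z" "z \<in> Z" for y z
    using hom_mult[OF \<pi>, of y z] that carrier_H by (simp add: H_def)
  have \<pi>_pow: "\<pi> z [^]\<^bsub>Q\<^esub> (m::int) = \<pi> (frag_cmul m z)" if "z \<in> Z" for z m
  proof -
    have "\<pi> (z [^]\<^bsub>H\<^esub> m) = \<pi> z [^]\<^bsub>Q\<^esub> m"
      using \<pi> H.is_group Q.is_group that carrier_H by (intro hom_int_pow) auto
    moreover have "z [^]\<^bsub>H\<^esub> m = frag_cmul m z"
      using that assms(4) carrier_H unfolding H_def by (subst F.int_pow_subgroup_generated) auto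
    ultimately show ?thesis by simp
  qed
  have \<pi>_eq: "\<pi> y = \<pi> z \<longleftrightarrow> y - z \<in> N" if "y \<in> Z" "z \<in> Z" for y z
  proof -
    have \<pi>_img: "\<pi> z = (\<lambda>n. n + z) ` N" for z
      by (auto simp: \<pi>_def r_coset_def H_def)
    show ?thesis
    proof
      assume "\<pi> y = \<pi> z"
      moreover have "y \<in> \<pi> y" using frag.subspace_0[OF N] by (auto simp: \<pi>_img image_iff)
      ultimately show "y - z \<in> N" by (auto simp: \<pi>_img)
    next
      assume yz: "y - z \<in> N"
      show "\<pi> y = \<pi> z"
      proof (intro equalityI subsetI)
        fix w assume "w \<in> \<pi> y"
        then obtain n where "n \<in> N" "w = n + y" by (auto simp: \<pi>_img)
        then have "n + (y - z) \<in> N" "w = n + (y - z) + z"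
          using yz frag.subspace_add[OF N] by auto
        then show "w \<in> \<pi> z" unfolding \<pi>_img by blast
      next
        fix w assume "w \<in> \<pi> z"
        then obtain n where "n \<in> N" "w = n + z" by (auto simp: \<pi>_img)
        then have "n - (y - z) \<in> N" "w = n - (y - z) + y"
          using yz frag.subspace_diff[OF N] by auto
        then show "w \<in> \<pi> y" unfolding \<pi>_img by blast
      qed
    qed
  qed
  have \<pi>_0: "\<pi> 0 = \<one>\<^bsub>Q\<^esub>"
    using hom_one[OF \<pi> H.is_group Q.is_group] by (simp add: H_def)
  have \<pi>_one: "\<pi> z = \<one>\<^bsub>Q\<^esub> \<longleftrightarrow> z \<in> N" if "z \<in> Z" for z
    using \<pi>_eq[OF that frag.subspace_0[OF Z]] \<pi>_0 by simp
  have in_Z: "(\<Sum>d\<in>D. frag_cmul (a d) d) \<in> Z" if "D \<subseteq> Z" for a D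
    using that Z by (intro frag.subspace_sum frag.subspace_scale) auto
  have prod: "finprod Q (\<lambda>b. b [^]\<^bsub>Q\<^esub> (a b :: int)) (\<pi> ` D) = \<pi> (\<Sum>d\<in>D. frag_cmul (a (\<pi> d)) d)"
    if "finite D" "D \<subseteq> Z" "inj_on \<pi> D" for a D
  proof -
    have "finprod Q (\<lambda>b. b [^]\<^bsub>Q\<^esub> a b) (\<pi> ` D) = finprod Q (\<lambda>d. \<pi> d [^]\<^bsub>Q\<^esub> a (\<pi> d)) D"
      using that \<pi>_carrier by (intro Q.finprod_reindex) auto
    also have "\<dots> = \<pi> (\<Sum>d\<in>D. frag_cmul (a (\<pi> d)) d)"
      using that(1,2)
    proof (induction D rule: finite_induct)
      case (insert d D)
      have "finprod Q (\<lambda>d. \<pi> d [^]\<^bsub>Q\<^esub> a (\<pi> d)) (insert d D)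
          = \<pi> d [^]\<^bsub>Q\<^esub> a (\<pi> d) \<otimes>\<^bsub>Q\<^esub> finprod Q (\<lambda>d. \<pi> d [^]\<^bsub>Q\<^esub> a (\<pi> d)) D"
        using insert \<pi>_carrier by (intro Q.finprod_insert) auto
      then show ?case
        using insert in_Z[of D "\<lambda>d. a (\<pi> d)"] Z
        by (simp add: \<pi>_pow \<pi>_add frag.subspace_scale)
    qed (simp add: \<pi>_0)
    finally show ?thesis .
  qed
  have "{card B |B. finite B \<and> B \<subseteq> carrier Q \<and> int_independent Q B}
      = {card D |D. D \<subseteq> Z \<and> frag.rel_independent N D}"
  proof (intro equalityI subsetI)
    fix k assume "k \<in> {card B |B. finite B \<and> B \<subseteq> carrier Q \<and> int_independent Q B}"
    then obtain B where B: "k = card B" "finite B" "B \<subseteq> carrier Q" "int_independent Q B" by blast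
    have "carrier Q = \<pi> ` Z" by (simp add: Q_def \<pi>_def carrier_FactGroup carrier_H)
    then obtain D where D: "D \<subseteq> Z" "inj_on \<pi> D" "B = \<pi> ` D"
      using B(3) by (metis subset_image_inj)
    then have finD: "finite D" using B(2) finite_image_iff by blast
    have "a d = 0" if a: "(\<Sum>d\<in>D. frag_cmul (a d) d) \<in> N" and d: "d \<in> D" for a d
    proof -
      define a' where "a' = (\<lambda>b. a (the_inv_into D \<pi> b))"
      have a': "a' (\<pi> d) = a d" if "d \<in> D" for d
        using D(2) that by (simp add: a'_def the_inv_into_f_f)
      then have "(\<Sum>d\<in>D. frag_cmul (a' (\<pi> d)) d) = (\<Sum>d\<in>D. frag_cmul (a d) d)" by simp
      then have "finprod Q (\<lambda>b. b [^]\<^bsub>Q\<^esub> a' b) B = \<one>\<^bsub>Q\<^esub>"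
        using prod[OF finD D(1,2), of a'] a D \<pi>_one in_Z[OF D(1)] by simp
      then have "\<forall>b\<in>B. a' b = 0" using B(4) unfolding int_independent_def by simp
      then show "a d = 0" using a' d D(3) by auto
    qed
    then have "frag.rel_independent N D" using finD unfolding frag.rel_independent_def by simp
    then show "k \<in> {card D |D. D \<subseteq> Z \<and> frag.rel_independent N D}"
      using D B(1) card_image by blast
  next
    fix k assume "k \<in> {card D |D. D \<subseteq> Z \<and> frag.rel_independent N D}"
    then obtain D where D: "k = card D" "D \<subseteq> Z" "frag.rel_independent N D" by blast
    have finD: "finite D" using D(3) by (simp add: frag.rel_independent_def)
    have inj: "inj_on \<pi> D"
      using D \<pi>_eq frag.rel_independent_diff_not_mem[OF D(3)] by (intro inj_onI) blast
    have "a b = 0" if a: "finprod Q (\<lambda>b. b [^]\<^bsub>Q\<^esub> a b) (\<pi> ` D) = \<one>\<^bsub>Q\<^esub>" and b: "b \<in> \<pi> ` D"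
      for a :: "_ \<Rightarrow> int" and b
    proof -
      have "(\<Sum>d\<in>D. frag_cmul (a (\<pi> d)) d) \<in> N"
        using a prod[OF finD D(2) inj, of a] \<pi>_one in_Z[OF D(2)] by simp
      from frag.rel_independentD[OF D(3) this] show ?thesis using b by auto
    qed
    then have "int_independent Q (\<pi> ` D)" unfolding int_independent_def by simp
    moreover have "\<pi> ` D \<subseteq> carrier Q" using D(2) \<pi>_carrier by auto
    moreover have "k = card (\<pi> ` D)" using D(1) inj by (simp add: card_image)
    ultimately show "k \<in> {card B |B. finite B \<and> B \<subseteq> carrier Q \<and> int_independent Q B}"
      using finD by blast
  qed
  then show ?thesis unfolding group_rank_def frag.rel_rank_def Q_def H_def by simp
qed


section \<open>Components\<close>

lemma sym_adjacency: "sym (adjacency G S)"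
proof (rule symI)
  fix u v assume "(u, v) \<in> adjacency G S"
  then obtain e where "e \<in> S" "ends G e = Upair u v" by (auto simp: adjacency_def)
  then have "ends G e = Upair v u" by auto
  with \<open>e \<in> S\<close> show "(v, u) \<in> adjacency G S" by (auto simp: adjacency_def)
qed

lemma rtrancl_adjacency_sym:
  "(u, v) \<in> (adjacency G S)\<^sup>* \<longleftrightarrow> (v, u) \<in> (adjacency G S)\<^sup>*"
  using sym_rtrancl[OF sym_adjacency] by (metis symD)

lemma component_eq_iff:
  "component G S u = component G S v \<longleftrightarrow> (u, v) \<in> (adjacency G S)\<^sup>*"
proof
  assume "component G S u = component G S v"
  moreover have "v \<in> component G S v" by (simp add: component_def)
  ultimately show "(u, v) \<in> (adjacency G S)\<^sup>*" by (auto simp: component_def)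
next
  assume "(u, v) \<in> (adjacency G S)\<^sup>*"
  then show "component G S u = component G S v"
    unfolding component_def by (auto intro: rtrancl_trans dest: rtrancl_adjacency_sym[THEN iffD1])
qed

lemma mem_component_iff: "v \<in> component G S u \<longleftrightarrow> component G S v = component G S u"
  by (metis Image_singleton_iff component_def component_eq_iff)

lemma component_insert_eq_iff:
  assumes "ends G e = Upair u v"
  shows "component G (insert e S) y = component G (insert e S) z \<longleftrightarrow>
    component G S y = component G S z \<or>
    component G S y \<in> {component G S u, component G S v} \<and>
    component G S z \<in> {component G S u, component G S v}"
proof -
  have adj: "adjacency G (insert e S) = insert (u, v) (insert (v, u) (adjacency G S))"
    using assms by (auto simp: adjacency_def)
  show ?thesis
    unfolding component_eq_iff adj rtrancl_insert insert_iff empty_iff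
    using rtrancl_adjacency_sym[where G = G and S = S]
    by (auto intro: rtrancl_trans; meson rtrancl_trans)
qed

lemma component_insert:
  assumes "ends G e = Upair u v"
  shows "component G (insert e S) y =
    (if component G S y \<in> {component G S u, component G S v}
     then component G S u \<union> component G S v else component G S y)"
  (is "_ = ?rhs")
proof (rule Set.set_eqI)
  fix z
  show "z \<in> component G (insert e S) y \<longleftrightarrow> z \<in> ?rhs"
    unfolding mem_component_iff component_insert_eq_iff[OF assms]
    by (auto simp: mem_component_iff)
qed

lemma components_insert:
  assumes "ends G e = Upair u v" "L \<in> components G (insert e S)"
  shows "L = component G S u \<union> component G S v \<or> L \<in> components G S"
proof -
  obtain y where "y \<in> nodes G" "L = component G (insert e S) y"
    using assms(2) unfolding components_def by blast
  then show ?thesis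
    unfolding component_insert[OF assms(1)] components_def by auto
qed


section \<open>Merging the colors at the ends of an edge\<close>

text \<open>The coloring of the components after an edge with ends \<open>u\<close> and \<open>v\<close> is added to \<open>S\<close>. Colors are
  arbitrary ring elements here, and \<open>0\<close> stands for a product that vanishes.\<close>

definition merge ::
  "('v, 'e) multigraph \<Rightarrow> 'e set \<Rightarrow> 'v \<Rightarrow> 'v \<Rightarrow> ('v set \<Rightarrow> 'a :: comm_ring) \<Rightarrow> 'v set \<Rightarrow> 'a" where
  "merge G S u v c L =
     (let K = component G S u; K' = component G S v
      in if L = K \<union> K' then if K = K' then c K else c K * c K' else c L)"

text \<open>The chain given by an edge set and a coloring that may take the value \<open>0\<close>: it is \<open>0\<close> if some
  component has the color \<open>0\<close>. Values of \<open>c\<close> at sets that are not components are disregarded.\<close>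

definition state_or_zero ::
  "('v, 'e) multigraph \<Rightarrow> 'e set \<Rightarrow> ('v set \<Rightarrow> 'a :: comm_ring) \<Rightarrow> ('v, 'e, 'a) state \<Rightarrow>\<^sub>0 int" where
  "state_or_zero G S c =
     (if \<exists>L\<in>components G S. c L = 0 then 0 else frag_of (S, restrict c (components G S)))"

lemma merge_component:
  assumes "ends G e = Upair u v"
  shows "merge G S u v c (component G (insert e S) y) =
    (if component G S y \<in> {component G S u, component G S v}
     then if component G S u = component G S v then c (component G S u)
       else c (component G S u) * c (component G S v)
     else c (component G S y))"
proof (cases "component G S y \<in> {component G S u, component G S v}")
  case True
  then show ?thesis by (auto simp: component_insert[OF assms] merge_def)
next
  case False
  then have "y \<notin> component G S u \<union> component G S v" by (auto simp: mem_component_iff)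
  moreover have "y \<in> component G S y" by (simp add: mem_component_iff)
  ultimately have "component G S y \<noteq> component G S u \<union> component G S v" by blast
  with False show ?thesis by (auto simp: component_insert[OF assms] merge_def)
qed

text \<open>Commutation of two merges, with the components abstracted to arbitrary objects: \<open>i\<close>, \<open>j\<close> and \<open>k\<close>, \<open>l\<close> are
  the components at the ends of the two edges, \<open>C i j\<close> is the coloring after the merge of \<open>i\<close> and \<open>j\<close>, and
  \<open>E i j\<close> says that two objects coincide after that merge.\<close>

lemma merge_commute_aux:
  fixes c :: "'k \<Rightarrow> 'a :: comm_ring"
  defines "C \<equiv> (\<lambda>i j p. if p = i \<or> p = j then if i = j then c i else c i * c j else c p)"
    and "E \<equiv> (\<lambda>i j p q. p = q \<or> (p = i \<or> p = j) \<and> (q = i \<or> q = j))"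
  shows "(if E i j y k \<or> E i j y l then if E i j k l then C i j k else C i j k * C i j l else C i j y)
       = (if E k l y i \<or> E k l y j then if E k l i j then C k l i else C k l i * C k l j else C k l y)"
  unfolding C_def E_def
  by (cases "i = j"; cases "k = l"; cases "i = k"; cases "i = l"; cases "j = k"; cases "j = l")
    (auto simp: mult_ac)

lemma merge_commute:
  assumes e: "ends G e = Upair u v" and f: "ends G f = Upair w z"
  shows "merge G (insert e S) w z (merge G S u v c) (component G (insert f (insert e S)) y)
       = merge G (insert f S) u v (merge G S w z c) (component G (insert e (insert f S)) y)"
  unfolding merge_component[OF f, of "insert e S"] merge_component[OF e, of "insert f S"]
    merge_component[OF e, of S] merge_component[OF f, of S]
    insert_iff empty_iff HOL.simp_thms component_insert_eq_iff[OF e, of S]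
    component_insert_eq_iff[OF f, of S]
  by (rule merge_commute_aux)

lemma state_or_zero_cong:
  assumes "\<And>y. y \<in> nodes G \<Longrightarrow> c (component G S y) = c' (component G S y)"
  shows "state_or_zero G S c = state_or_zero G S c'"
proof -
  have eq: "c L = c' L" if "L \<in> components G S" for L
    using that assms by (auto simp: components_def)
  then have "restrict c (components G S) = restrict c' (components G S)" by (rule restrict_ext)
  then show ?thesis using eq by (simp add: state_or_zero_def)
qed

context finite_graph
begin

lemma ends_nodes:
  assumes "e \<in> edges G" "ends G e = Upair u v"
  shows "u \<in> nodes G" "v \<in> nodes G"
  using ends_in_nodes[OF assms(1)] assms(2) by auto

text \<open>Either order of the ends of \<open>e\<close> may be used in place of the one chosen by the definition.\<close>

lemma partial_edge_eq:
  assumes "ends G e = Upair u v"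
  shows "partial_edge G e (S, c) =
    (let K = component G S u; K' = component G S v;
         recolor = (\<lambda>y. \<lambda>L\<in>components G (insert e S). if L = K \<union> K' then y else c L)
     in if K = K' then frag_of (insert e S, recolor (c K))
        else if c K * c K' = 0 then 0
        else frag_of (insert e S, recolor (c K * c K')))"
proof -
  obtain u' v' where uv: "(SOME (u, v). ends G e = Upair u v) = (u', v')" by fastforce
  have "(case (u', v') of (u, v) \<Rightarrow> ends G e = Upair u v)"
    unfolding uv[symmetric] by (rule someI[of _ "(u, v)"]) (simp add: assms)
  then consider "u' = u" "v' = v" | "u' = v" "v' = u" using assms by auto
  then show ?thesis
  proof cases
    case 1
    then show ?thesis by (simp only: partial_edge_def uv prod.case Let_def)
  next
    case 2
    show ?thesis
    proof (cases "component G S u = component G S v")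
      case False
      then show ?thesis
        using False[symmetric] by (simp add: partial_edge_def uv 2 Let_def Un_commute mult.commute cong: if_cong)
    qed (simp add: partial_edge_def uv 2 Let_def)
  qed
qed

lemma partial_edge_merge:
  assumes e: "e \<in> edges G" "ends G e = Upair u v"
    and nz: "\<And>L. L \<in> components G S \<Longrightarrow> c L \<noteq> 0"
  shows "partial_edge G e (S, restrict c (components G S)) =
    state_or_zero G (insert e S) (merge G S u v c)"
proof -
  let ?K = "component G S u" and ?K' = "component G S v"
  have K: "?K \<in> components G S" "?K' \<in> components G S"
    using ends_nodes[OF e] by (auto simp: components_def)
  have KK: "?K \<union> ?K' \<in> components G (insert e S)"
    using ends_nodes[OF e] component_insert[OF e(2), of S u] by (auto simp: components_def)
  have old: "L \<in> components G S" if "L \<in> components G (insert e S)" "L \<noteq> ?K \<union> ?K'" for L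
    using components_insert[OF e(2)] that by blast
  have zero: "(\<exists>L\<in>components G (insert e S). merge G S u v c L = 0) \<longleftrightarrow> ?K \<noteq> ?K' \<and> c ?K * c ?K' = 0"
    using KK nz K old unfolding merge_def Let_def by metis
  let ?c = "restrict c (components G S)"
  define recolor where
    "recolor y = (\<lambda>L\<in>components G (insert e S). if L = ?K \<union> ?K' then y else ?c L)" for y
  have recolor: "recolor (if ?K = ?K' then ?c ?K else ?c ?K * ?c ?K')
      = restrict (merge G S u v c) (components G (insert e S))"
    unfolding recolor_def using old K by (intro restrict_ext) (auto simp: merge_def Let_def)
  have "partial_edge G e (S, ?c) = (if ?K \<noteq> ?K' \<and> ?c ?K * ?c ?K' = 0 then 0
      else frag_of (insert e S, recolor (if ?K = ?K' then ?c ?K else ?c ?K * ?c ?K')))"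
    unfolding partial_edge_eq[OF e(2)] Let_def recolor_def
    by (cases "?K = ?K'") (simp_all only: if_True if_False simp_thms)
  then show ?thesis
    unfolding recolor state_or_zero_def zero using K by simp
qed

lemma frag_extend_partial_edge:
  assumes e: "e \<in> edges G" "ends G e = Upair u v"
  shows "frag_extend (partial_edge G e) (state_or_zero G S c) =
    state_or_zero G (insert e S) (merge G S u v c)"
proof (cases "\<exists>L\<in>components G S. c L = 0")
  case True
  then obtain y where y: "y \<in> nodes G" "c (component G S y) = 0" by (auto simp: components_def)
  then have "merge G S u v c (component G (insert e S) y) = 0"
    by (auto simp: merge_component[OF e(2)])
  then have "\<exists>L\<in>components G (insert e S). merge G S u v c L = 0"
    using y(1) by (auto simp: components_def)
  with True show ?thesis by (simp add: state_or_zero_def)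
next
  case False
  then have nz: "\<And>L. L \<in> components G S \<Longrightarrow> c L \<noteq> 0" by blast
  have "state_or_zero G S c = frag_of (S, restrict c (components G S))"
    using False by (simp only: state_or_zero_def if_False)
  then show ?thesis by (simp only: frag_extend_of partial_edge_merge[OF e nz])
qed

lemma partial_edge_commute:
  assumes "e \<in> edges G" "f \<in> edges G"
  shows "frag_extend (partial_edge G f) (frag_extend (partial_edge G e) (state_or_zero G S c)) =
         frag_extend (partial_edge G e) (frag_extend (partial_edge G f) (state_or_zero G S c))"
proof -
  obtain u v where e: "ends G e = Upair u v" by (cases "ends G e")
  obtain w z where f: "ends G f = Upair w z" by (cases "ends G f")
  show ?thesis
    unfolding frag_extend_partial_edge[OF assms(1) e] frag_extend_partial_edge[OF assms(2) f]
      insert_commute[of f e]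
    using merge_commute[OF e f, of S c] by (intro state_or_zero_cong) (simp only: insert_commute[of f e])
qed

end


section \<open>The differential\<close>

lemma sum_antisymmetric_eq_0:
  fixes g :: "'i \<Rightarrow> 'i \<Rightarrow> 'b \<Rightarrow>\<^sub>0 int"
  assumes "\<And>i j. i \<in> A \<Longrightarrow> j \<in> A \<Longrightarrow> g i j = - g j i"
  shows "(\<Sum>i\<in>A. \<Sum>j\<in>A. g i j) = 0"
proof -
  have "(\<Sum>i\<in>A. \<Sum>j\<in>A. g i j) = (\<Sum>i\<in>A. \<Sum>j\<in>A. - g j i)"
    using assms by (intro sum.cong refl) blast
  also have "\<dots> = - (\<Sum>i\<in>A. \<Sum>j\<in>A. g i j)"
    by (subst sum.swap) (simp add: sum_negf)
  finally have "frag_cmul 2 (\<Sum>i\<in>A. \<Sum>j\<in>A. g i j) = 0"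
    by (metis add.right_inverse frag_cmul_distrib frag_cmul_one one_add_one)
  then show ?thesis by simp
qed

context finite_graph
begin

text \<open>Of two edges outside \<open>S\<close>, adding the earlier one lowers by one the number of edges that precede
  the later one, while adding the later one does not affect the earlier one.\<close>

lemma sign_antisymmetric:
  assumes ord: "linear_order_on (edges G) ord"
    and "e \<in> edges G - S" "f \<in> edges G - S" "e \<noteq> f"
  shows "(-1 :: int) ^ preceding G ord S e * (-1) ^ preceding G ord (insert e S) f =
    - ((-1) ^ preceding G ord S f * (-1) ^ preceding G ord (insert f S) e)"
proof -
  have *: "(-1 :: int) ^ preceding G ord S e * (-1) ^ preceding G ord (insert e S) f =
      - ((-1) ^ preceding G ord S f * (-1) ^ preceding G ord (insert f S) e)"
    if "e \<in> edges G - S" "f \<in> edges G - S" "e \<noteq> f" and ef: "(e, f) \<in> ord" for e f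
  proof -
    have "(f, e) \<notin> ord"
      using ord that by (auto simp: order_on_defs dest: antisymD)
    then have "{g \<in> edges G - insert f S. g \<noteq> e \<and> (g, e) \<in> ord} = {g \<in> edges G - S. g \<noteq> e \<and> (g, e) \<in> ord}"
      by auto
    then have e: "preceding G ord (insert f S) e = preceding G ord S e"
      by (simp add: preceding_def)
    have "{g \<in> edges G - S. g \<noteq> f \<and> (g, f) \<in> ord}
        = insert e {g \<in> edges G - insert e S. g \<noteq> f \<and> (g, f) \<in> ord}"
      using that by auto
    then have "preceding G ord S f = Suc (preceding G ord (insert e S) f)"
      using finite_edges by (simp add: preceding_def)
    with e show ?thesis by simp
  qed
  have "(e, f) \<in> ord \<or> (f, e) \<in> ord"
    using ord assms by (auto simp: order_on_defs total_on_def)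
  then show ?thesis
  proof
    assume "(e, f) \<in> ord"
    then show ?thesis using * assms by blast
  next
    assume "(f, e) \<in> ord"
    then show ?thesis using *[of f e] assms by simp
  qed
qed

lemma differential_state_or_zero:
  "differential G ord (state_or_zero G S c) = (\<Sum>e\<in>edges G - S.
     frag_cmul ((-1) ^ preceding G ord S e) (frag_extend (partial_edge G e) (state_or_zero G S c)))"
  by (simp add: differential_def state_or_zero_def)

lemma differential_differential_state_or_zero:
  assumes ord: "linear_order_on (edges G) ord"
  shows "differential G ord (differential G ord (state_or_zero G S c)) = 0"
proof -
  let ?s = "state_or_zero G S c"
  let ?A = "edges G - S"
  let ?p = "\<lambda>S e. (-1 :: int) ^ preceding G ord S e"
  let ?d = "\<lambda>e. frag_extend (partial_edge G e)"
  interpret d: module_hom frag_cmul frag_cmul "differential G ord"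
    unfolding differential_def by (rule module_hom_frag_extend)
  \<comment> \<open>The contribution of adding \<open>e\<close> first and \<open>f\<close> second.\<close>
  define g where "g e f = (if e = f then 0
    else frag_cmul (?p S e * ?p (insert e S) f) (?d f (?d e ?s)))" for e f
  have d_edge: "differential G ord (?d e ?s)
      = (\<Sum>f\<in>edges G - insert e S. frag_cmul (?p (insert e S) f) (?d f (?d e ?s)))"
    if e: "e \<in> edges G" for e
  proof -
    obtain u v where "ends G e = Upair u v" by (cases "ends G e")
    from frag_extend_partial_edge[OF e this, of S c] show ?thesis
      by (simp only: differential_state_or_zero)
  qed
  have "differential G ord (differential G ord ?s)
      = (\<Sum>e\<in>?A. frag_cmul (?p S e) (differential G ord (?d e ?s)))"
    by (simp only: differential_state_or_zero d.sum d.scale)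
  also have "\<dots> = (\<Sum>e\<in>?A. \<Sum>f\<in>?A. g e f)"
  proof (rule sum.cong[OF refl])
    fix e assume e: "e \<in> ?A"
    have "frag_cmul (?p S e) (differential G ord (?d e ?s)) = (\<Sum>f\<in>edges G - insert e S. g e f)"
      using e by (subst d_edge, simp, simp only: frag_cmul_sum, intro sum.cong) (auto simp: g_def)
    also have "\<dots> = (\<Sum>f\<in>?A. g e f)"
      using finite_edges by (intro sum.mono_neutral_left) (auto simp: g_def)
    finally show "frag_cmul (?p S e) (differential G ord (?d e ?s)) = (\<Sum>f\<in>?A. g e f)" .
  qed
  also have "\<dots> = 0"
  proof (rule sum_antisymmetric_eq_0)
    fix e f assume ef: "e \<in> ?A" "f \<in> ?A"
    show "g e f = - g f e"
    proof (cases "e = f")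
      case False
      have "?d f (?d e ?s) = ?d e (?d f ?s)"
        using ef by (intro partial_edge_commute) auto
      then show ?thesis
        using sign_antisymmetric[OF ord ef False] False by (simp add: g_def)
    qed (simp add: g_def)
  qed
  finally show ?thesis .
qed

end

text \<open>A finite graph with linearly ordered edges, and a finite set of nonzero colors that is closed under
  multiplication up to \<open>0\<close>: all that the construction of the color complex uses.\<close>

locale color_set = finite_graph G
  for G :: "('v, 'e) multigraph" +
  fixes X :: "'a :: comm_ring set" and ord :: "'e rel"
  assumes finite_colors: "finite X"
    and zero_not_color: "0 \<notin> X"
    and color_mult: "\<And>a b. a \<in> X \<Longrightarrow> b \<in> X \<Longrightarrow> a * b \<in> X \<or> a * b = 0"
    and ord: "linear_order_on (edges G) ord"
begin

abbreviation chains :: "nat \<Rightarrow> (('v, 'e, 'a) state \<Rightarrow>\<^sub>0 int) set" where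
  "chains k \<equiv> carrier (chain_group G X k)"

lemma finite_components: "finite (components G S)"
  using finite_nodes by (simp add: components_def)

lemma finite_states: "finite (states G X k)"
proof -
  have "states G X k \<subseteq> Sigma (Pow (edges G)) (\<lambda>S. components G S \<rightarrow>\<^sub>E X)"
    by (auto simp: states_def)
  then show ?thesis
    using finite_edges finite_components finite_colors
    by (meson finite_PiE finite_Pow_iff finite_SigmaI finite_subset)
qed

lemma subspace_chains: "frag.subspace (chains k)"
  unfolding chain_group_def
  by (rule frag.subspaceI)
    (auto dest: subsetD[OF keys_add])

lemma frag_of_state:
  assumes "(S, c) \<in> states G X k"
  shows "frag_of (S, c) = state_or_zero G S c"
proof -
  have c: "c \<in> components G S \<rightarrow>\<^sub>E X" using assms by (simp add: states_def)
  then have "restrict c (components G S) = c" by (rule PiE_restrict)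
  moreover have "\<forall>L\<in>components G S. c L \<noteq> 0" using c zero_not_color by (metis PiE_mem)
  ultimately show ?thesis by (simp add: state_or_zero_def)
qed

lemma partial_edge_chains:
  assumes "s \<in> states G X k" "e \<in> edges G - fst s"
  shows "partial_edge G e s \<in> chains (Suc k)"
proof -
  obtain S c where s: "s = (S, c)" by (cases s)
  have S: "S \<subseteq> edges G" "card S = k" "c \<in> components G S \<rightarrow>\<^sub>E X"
    using assms(1) by (auto simp: s states_def)
  have e: "e \<in> edges G" "e \<notin> S" using assms(2) by (auto simp: s)
  obtain u v where uv: "ends G e = Upair u v" by (cases "ends G e")
  have K: "component G S u \<in> components G S" "component G S v \<in> components G S"
    using ends_nodes[OF e(1) uv] by (auto simp: components_def)
  have color: "merge G S u v c L \<in> X \<or> merge G S u v c L = 0" if "L \<in> components G (insert e S)" for L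
    using components_insert[OF uv that] S(3) K color_mult by (auto simp: merge_def Let_def)
  have "finite S" using S(1) finite_edges finite_subset by blast
  then have "(insert e S, restrict (merge G S u v c) (components G (insert e S))) \<in> states G X (Suc k)"
    if "\<forall>L\<in>components G (insert e S). merge G S u v c L \<noteq> 0"
    using that color S e by (auto simp: states_def)
  then have "state_or_zero G (insert e S) (merge G S u v c) \<in> chains (Suc k)"
    by (simp add: state_or_zero_def chain_group_def)
  moreover have "partial_edge G e s = state_or_zero G (insert e S) (merge G S u v c)"
    using frag_extend_partial_edge[OF e(1) uv, of S c] frag_of_state assms(1) s
    by (metis frag_extend_of)
  ultimately show ?thesis by simp
qed

lemma module_hom_differential: "module_hom frag_cmul frag_cmul (differential G ord)"
  unfolding differential_def by (rule module_hom_frag_extend)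

lemma differential_chains:
  assumes "c \<in> chains k"
  shows "differential G ord c \<in> chains (Suc k)"
proof -
  interpret d: module_hom frag_cmul frag_cmul "differential G ord"
    by (rule module_hom_differential)
  have "Poly_Mapping.keys c \<subseteq> states G X k" using assms by (simp add: chain_group_def)
  then show ?thesis
  proof (induction c rule: free_Abelian_group_induct[consumes 1, case_names zero diff of])
    case zero
    then show ?case using frag.subspace_0[OF subspace_chains] by (simp add: d.zero)
  next
    case (diff x y)
    then show ?case using frag.subspace_diff[OF subspace_chains] by (simp add: d.diff)
  next
    case (of s)
    then show ?case
      unfolding differential_def frag_extend_of
      by (intro frag.subspace_sum frag.subspace_scale subspace_chains partial_edge_chains)
  qed
qed

lemma differential_differential:
  assumes "c \<in> chains k"
  shows "differential G ord (differential G ord c) = 0"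
proof -
  interpret d: module_hom frag_cmul frag_cmul "differential G ord"
    by (rule module_hom_differential)
  have "Poly_Mapping.keys c \<subseteq> states G X k" using assms by (simp add: chain_group_def)
  then show ?thesis
  proof (induction c rule: free_Abelian_group_induct[consumes 1, case_names zero diff of])
    case (of s)
    obtain S c where s: "s = (S, c)" by (cases s)
    show ?case
      using frag_of_state of differential_differential_state_or_zero[OF ord] by (simp add: s)
  qed (simp_all add: d.zero d.diff)
qed

lemma chains_top: "chains (Suc (card (edges G))) = {0}"
proof -
  have "card S \<noteq> Suc (card (edges G))" if "S \<subseteq> edges G" for S
    using card_mono[OF finite_edges that] by simp
  then have "states G X (Suc (card (edges G))) = {}" by (auto simp: states_def)
  then show ?thesis by (auto simp: chain_group_def free_Abelian_group_def)
qed

lemma group_rank_color_homology: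
  "group_rank (color_homology G ord X k) =
     frag.rel_rank {c \<in> chains k. differential G ord c = 0}
       (case k of 0 \<Rightarrow> {0} | Suc j \<Rightarrow> differential G ord ` chains j)"
proof -
  interpret d: module_hom frag_cmul frag_cmul "differential G ord"
    by (rule module_hom_differential)
  have cycles: "cycles G ord X k = {c \<in> chains k. differential G ord c = 0}"
    by (simp add: cycles_def kernel_def chain_group_def)
  have "frag.subspace {c \<in> chains k. differential G ord c = 0}"
    using subspace_chains[of k] by (auto simp: frag.subspace_def d.add d.scale d.zero)
  moreover have "frag.subspace (boundaries G ord X k)"
    using subspace_chains by (auto simp: boundaries_def split: nat.split intro: d.subspace_image)
  moreover have "boundaries G ord X k \<subseteq> {c \<in> chains k. differential G ord c = 0}"
    using frag.subspace_0[OF subspace_chains, of k] differential_chains differential_differential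
    by (auto simp: boundaries_def d.zero split: nat.splits)
  moreover have "{c \<in> chains k. differential G ord c = 0} \<subseteq> chains k" by blast
  ultimately have "group_rank (color_homology G ord X k) =
      frag.rel_rank {c \<in> chains k. differential G ord c = 0} (boundaries G ord X k)"
    unfolding color_homology_def cycles unfolding chain_group_def by (rule group_rank_quotient)
  then show ?thesis by (simp only: boundaries_def)
qed

theorem homology_euler_char_eq:
  "homology_euler_char G ord X = (\<Sum>k\<le>card (edges G). (-1) ^ k * int (card (states G X k)))"
proof -
  have "inj_on frag_of (states G X k)" for k
    by (simp add: inj_on_def frag_of_eq)
  then have "card (frag_of ` states G X k) = card (states G X k)" for k
    by (rule card_image)
  moreover have "frag.rel_basis (chains k) {0} (frag_of ` states G X k)" for k
    unfolding chain_group_def by (rule rel_basis_free_Abelian_group[OF finite_states])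
  ultimately show ?thesis
    using frag.euler_poincare[OF module_hom_differential, of chains "\<lambda>k. frag_of ` states G X k" "card (edges G)"]
      subspace_chains differential_chains differential_differential chains_top
    by (simp add: homology_euler_char_def group_rank_color_homology)
qed

end


section \<open>Counting states and colorings\<close>

lemma sum_Pow_alternating:
  assumes "finite M"
  shows "(\<Sum>S\<in>Pow M. (-1 :: int) ^ card S) = (if M = {} then 1 else 0)"
  using assms
proof (induction M rule: finite_induct)
  case (insert x M)
  have "Pow (insert x M) = Pow M \<union> insert x ` Pow M" by (rule Pow_insert)
  moreover have "Pow M \<inter> insert x ` Pow M = {}" using insert.hyps by auto
  moreover have "inj_on (insert x) (Pow M)" using insert.hyps by (auto simp: inj_on_def)
  moreover have "(-1 :: int) ^ card (insert x S) = - ((-1) ^ card S)" if "S \<in> Pow M" for S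
    using that insert.hyps finite_subset by (subst card_insert_disjoint) auto
  ultimately show ?case
    using insert.hyps by (simp add: sum.union_disjoint sum.reindex sum_negf)
qed simp

text \<open>The edges whose ends have the same color.\<close>

definition monochromatic :: "('v, 'e) multigraph \<Rightarrow> ('v \<Rightarrow> 'c) \<Rightarrow> 'e set" where
  "monochromatic G f = {e \<in> edges G. \<exists>u v. ends G e = Upair u v \<and> f u = f v}"

context finite_graph
begin

text \<open>Colorings of the components of \<open>S\<close> correspond to node colorings that are constant on them.\<close>

lemma bij_betw_component_colorings:
  fixes X :: "'c set"
  assumes "S \<subseteq> edges G"
  shows "bij_betw (\<lambda>c. \<lambda>y\<in>nodes G. c (component G S y)) (components G S \<rightarrow>\<^sub>E X)
    {f \<in> nodes G \<rightarrow>\<^sub>E X. S \<subseteq> monochromatic G f}"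
    (is "bij_betw ?\<Phi> ?A ?B")
proof (rule bij_betw_imageI)
  show "inj_on ?\<Phi> ?A"
  proof (rule inj_onI)
    fix c c' assume c: "c \<in> ?A" "c' \<in> ?A" and eq: "?\<Phi> c = ?\<Phi> c'"
    have "c (component G S y) = c' (component G S y)" if "y \<in> nodes G" for y
      using fun_cong[OF eq, of y] that by simp
    then show "c = c'" using c by (intro PiE_ext) (auto simp: components_def)
  qed
  show "?\<Phi> ` ?A = ?B"
  proof (intro equalityI subsetI)
    fix f assume "f \<in> ?\<Phi> ` ?A"
    then obtain c where c: "c \<in> ?A" "f = ?\<Phi> c" by blast
    have "e \<in> monochromatic G f" if "e \<in> S" for e
    proof -
      obtain u v where uv: "ends G e = Upair u v" by (cases "ends G e")
      have "(u, v) \<in> adjacency G S" using that uv by (auto simp: adjacency_def)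
      then have "component G S u = component G S v" by (auto simp: component_eq_iff)
      moreover have "u \<in> nodes G" "v \<in> nodes G" using ends_nodes[OF _ uv] that assms by auto
      ultimately have "f u = f v" by (simp add: c(2))
      then show ?thesis using that uv assms by (auto simp: monochromatic_def)
    qed
    then show "f \<in> ?B" using c by (auto simp: components_def)
  next
    fix f assume f: "f \<in> ?B"
    have adj: "f u = f v" if "(u, v) \<in> adjacency G S" for u v
    proof -
      obtain e where e: "e \<in> S" "ends G e = Upair u v" using \<open>(u, v) \<in> adjacency G S\<close> by (auto simp: adjacency_def)
      then have "e \<in> monochromatic G f" using f by blast
      then obtain u' v' where "ends G e = Upair u' v'" "f u' = f v'"
        unfolding monochromatic_def by blast
      with e(2) show ?thesis by auto
    qed
    have const: "f z = f y" if "z \<in> component G S y" for y z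
    proof -
      have "(y, z) \<in> (adjacency G S)\<^sup>*" using that by (simp add: component_def)
      then show ?thesis by (induction rule: rtrancl_induct) (auto dest: adj)
    qed
    define c where "c = (\<lambda>L\<in>components G S. f (SOME z. z \<in> L))"
    have c: "c (component G S y) = f y" if "y \<in> nodes G" for y
    proof -
      have "y \<in> component G S y" by (simp add: mem_component_iff)
      then have "(SOME z. z \<in> component G S y) \<in> component G S y" by (rule someI)
      then show ?thesis using const that by (simp add: c_def components_def)
    qed
    have "c \<in> ?A"
    proof (rule PiE_I)
      fix L assume "L \<in> components G S"
      then obtain y where "y \<in> nodes G" "L = component G S y" by (auto simp: components_def)
      then show "c L \<in> X" using c f by auto
    qed (simp add: c_def)
    moreover have "f = ?\<Phi> c"
    proof (rule extensionalityI[of f "nodes G"])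
      show "f \<in> extensional (nodes G)" using f by (auto simp: PiE_def)
    qed (simp_all add: c)
    ultimately show "f \<in> ?\<Phi> ` ?A" by blast
  qed
qed

lemma proper_colorings_monochromatic:
  "proper_colorings G n = {f \<in> nodes G \<rightarrow>\<^sub>E {1..n}. monochromatic G f = {}}"
  by (auto simp: proper_colorings_def monochromatic_def)

theorem sum_component_colorings:
  "(\<Sum>S\<in>Pow (edges G). (-1) ^ card S * int (n ^ card (components G S)))
     = int (card (proper_colorings G n))"
proof -
  let ?F = "nodes G \<rightarrow>\<^sub>E {1..n}"
  have fin: "finite ?F" using finite_nodes by (intro finite_PiE) auto
  have colorings: "int (n ^ card (components G S)) = (\<Sum>f\<in>?F. if S \<subseteq> monochromatic G f then 1 else 0)"
    if "S \<in> Pow (edges G)" for S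
  proof -
    have "finite (components G S)" using finite_nodes by (simp add: components_def)
    then have "n ^ card (components G S) = card (components G S \<rightarrow>\<^sub>E {1..n})"
      by (simp add: card_PiE)
    also have "\<dots> = card {f \<in> ?F. S \<subseteq> monochromatic G f}"
      using that by (intro bij_betw_same_card[OF bij_betw_component_colorings]) auto
    finally show ?thesis by (simp only: sum.inter_filter[OF fin, symmetric]) simp
  qed
  have inner: "(\<Sum>S\<in>Pow (edges G). (-1) ^ card S * (if S \<subseteq> monochromatic G f then 1 else 0))
      = (if monochromatic G f = {} then 1 else 0 :: int)" for f :: "'v \<Rightarrow> nat"
  proof -
    have sub: "monochromatic G f \<subseteq> edges G" by (auto simp: monochromatic_def)
    have "(\<Sum>S\<in>Pow (edges G). (-1) ^ card S * (if S \<subseteq> monochromatic G f then 1 else 0 :: int))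
        = (\<Sum>S\<in>Pow (monochromatic G f). (-1) ^ card S)"
      using sub finite_edges by (intro sum.mono_neutral_cong_right) auto
    then show ?thesis
      using sum_Pow_alternating[of "monochromatic G f"] finite_subset[OF sub finite_edges] by simp
  qed
  have "(\<Sum>S\<in>Pow (edges G). (-1) ^ card S * int (n ^ card (components G S)))
      = (\<Sum>S\<in>Pow (edges G). \<Sum>f\<in>?F. (-1) ^ card S * (if S \<subseteq> monochromatic G f then 1 else 0))"
    by (intro sum.cong refl) (simp only: colorings sum_distrib_left)
  also have "\<dots> = (\<Sum>f\<in>?F. if monochromatic G f = {} then 1 else 0)"
    by (subst sum.swap) (simp only: inner)
  also have "\<dots> = int (card (proper_colorings G n))"
    unfolding proper_colorings_monochromatic sum.inter_filter[OF fin, symmetric] by simp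
  finally show ?thesis .
qed

end

lemma (in color_set) sum_card_states:
  "(\<Sum>k\<le>card (edges G). (-1) ^ k * int (card (states G X k)))
     = (\<Sum>S\<in>Pow (edges G). (-1) ^ card S * int (card X ^ card (components G S)))"
proof -
  let ?E = "\<lambda>k. {S \<in> Pow (edges G). card S = k}"
  have "card (states G X k) = (\<Sum>S\<in>?E k. card X ^ card (components G S))" for k
  proof -
    have "states G X k = Sigma (?E k) (\<lambda>S. components G S \<rightarrow>\<^sub>E X)" by (auto simp: states_def)
    then show ?thesis
      using finite_edges finite_components finite_colors
      by (simp add: card_SigmaI finite_PiE card_PiE)
  qed
  then have "(\<Sum>k\<le>card (edges G). (-1) ^ k * int (card (states G X k)))
      = (\<Sum>k\<le>card (edges G). \<Sum>S\<in>?E k. (-1) ^ card S * int (card X ^ card (components G S)))"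
    by (simp add: sum_distrib_left)
  also have "\<dots> = (\<Sum>S\<in>Pow (edges G). (-1) ^ card S * int (card X ^ card (components G S)))"
    using finite_edges by (intro sum.group) (auto simp: card_mono)
  finally show ?thesis .
qed

theorem mainTheorem7:
  fixes G :: "('v, 'e) multigraph" and ord :: "'e rel"
    and n :: nat and scale :: "int \<Rightarrow> 'a :: comm_ring \<Rightarrow> 'a" and x :: "nat \<Rightarrow> 'a"
  assumes "finite_graph G"
    and "linear_order_on (edges G) ord"
    and "n \<ge> 1"
    and "color_algebra scale x n"
  shows "int (card (proper_colorings G n)) = homology_euler_char G ord (x ` {1..n})"
proof -
  interpret A: color_algebra scale x n by (rule assms(4))
  interpret finite_graph G by (rule assms(1))
  interpret color_set G "x ` {1..n}" ord
  proof
    show "0 \<notin> x ` {1..n}"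
      using A.colors_independent A.dependent_zero by auto
    show "a * b \<in> x ` {1..n} \<or> a * b = 0" if "a \<in> x ` {1..n}" "b \<in> x ` {1..n}" for a b
    proof -
      from that obtain r t where "r \<in> {1..n}" "t \<in> {1..n}" "a = x r" "b = x t" by blast
      then show ?thesis using A.colors_mult[of r t] by auto
    qed
  qed (use assms(2) in auto)
  have "card (x ` {1..n}) = n" using A.colors_inj by (simp add: card_image)
  then show ?thesis
    unfolding homology_euler_char_eq sum_card_states by (simp only: sum_component_colorings)
qed

end
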